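(* Let $r \geq 3$ and let $\mathcal{H}$ be a friendship $r$-hypergraph on $n \geq r+1$ vertices. Then \[ |E(\mathcal{H})| \leq \frac{2}{r(r+1)}\left\lfloor \frac{(r+1)(3r-4)}{6}\right\rfloor \binom{n}{r} + \frac{4}{r^2(r+1)}\left\lceil \frac{2(r+1)}{3} \right\rceil \binom{n}{r-1}. \] Moreover, if equality holds, then every set of $r-1$ vertices of $\mathcal{H}$ is contained in the same number of hyperedges of $\mathcal{H}$.
   Context: For an $r$-uniform hypergraph $\mathcal{H}$ and a set of vertices $A$, a vertex $u \notin A$ is a friend of $A$ in $\mathcal{H}$ if for every $B \subseteq A$ with $|B| = r-1$, the set $B \cup \{u\}$ is a hyperedge of $\mathcal{H}$. An $r$-uniform hypergraph is a friendship $r$-hypergraph if every set of $r$ vertices has exactly one friend. *)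

theory Defs
  imports Complex_Main
begin

text \<open>A hypergraph is given by its finite vertex set \<open>V\<close> and its set \<open>E\<close> of hyperedges.\<close>

definition uniform_hypergraph :: "nat \<Rightarrow> 'a set \<Rightarrow> 'a set set \<Rightarrow> bool" where
  "uniform_hypergraph r V E \<longleftrightarrow> finite V \<and> (\<forall>e\<in>E. e \<subseteq> V \<and> card e = r)"

definition is_friend :: "nat \<Rightarrow> 'a set \<Rightarrow> 'a set set \<Rightarrow> 'a set \<Rightarrow> 'a \<Rightarrow> bool" where
  "is_friend r V E A u \<longleftrightarrow>
     u \<in> V \<and> u \<notin> A \<and> (\<forall>B. B \<subseteq> A \<and> card B = r - 1 \<longrightarrow> B \<union> {u} \<in> E)"

definition friendship_hypergraph :: "nat \<Rightarrow> 'a set \<Rightarrow> 'a set set \<Rightarrow> bool" where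
  "friendship_hypergraph r V E \<longleftrightarrow> uniform_hypergraph r V E \<and>
     (\<forall>A. A \<subseteq> V \<and> card A = r \<longrightarrow> (\<exists>!u. is_friend r V E A u))"

definition hdegree :: "'a set set \<Rightarrow> 'a set \<Rightarrow> nat" where
  "hdegree E S = card {e \<in> E. S \<subseteq> e}"

definition friendship_bound :: "nat \<Rightarrow> nat \<Rightarrow> real" where
  "friendship_bound r n =
     2 / (real r * (real r + 1)) * of_int \<lfloor>(real r + 1) * (3 * real r - 4) / 6\<rfloor> * real (n choose r)
     + 4 / ((real r)\<^sup>2 * (real r + 1)) * of_int \<lceil>2 * (real r + 1) / 3\<rceil> * real (n choose (r - 1))"

end

theory Submission
  imports Defs
begin

text \<open>
  Every hyperedge extends to exactly one complete set, that is, an \<open>(r+1)\<close>-set all of whose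
  \<open>r\<close>-subsets are hyperedges. Let \<open>T\<close> be complete and \<open>v \<notin> T\<close>, and join \<open>x, y \<in> T\<close> when
  \<open>(T - {x, y}) \<union> {v}\<close> is not a hyperedge. An isolated vertex \<open>x\<close> of this graph would make both
  \<open>x\<close> and \<open>v\<close> friends of \<open>T - {x}\<close>; an isolated edge \<open>{x, y}\<close> would make both \<open>x\<close> and \<open>y\<close>
  friends of \<open>(T - {x, y}) \<union> {v}\<close>. Hence the graph has at least \<open>2(r+1)/3\<close> edges, which bounds the
  number of hyperedges meeting \<open>T\<close> in \<open>r - 1\<close> vertices. Summing over \<open>T\<close>, this number is also
  \<open>\<Sum>\<^sub>S d(S)(d(S) - 2)/2\<close> over the \<open>(r-1)\<close>-sets \<open>S\<close>, as the \<open>d(S)\<close> hyperedges containing \<open>S\<close> are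
  paired off by the complete sets. The Cauchy-Schwarz inequality then gives the bound, and its
  equality case the regularity.
\<close>

section \<open>Graphs without isolated vertices or isolated edges\<close>

text \<open>Discharging: every vertex splits weight 1 evenly among the pairs at it, so the pairs
  together receive \<open>card T\<close>. One end of each pair lies in a further pair and sends at
  most 1/2, the other end at most 1, so a pair receives at most 3/2.\<close>

lemma card_pairs_no_isolated:
  fixes T :: "'a set" and M :: "'a set set"
  assumes T: "finite T" and M: "\<And>p. p \<in> M \<Longrightarrow> p \<subseteq> T \<and> card p = 2"
    and vertex: "\<And>x. x \<in> T \<Longrightarrow> \<exists>p\<in>M. x \<in> p"
    and edge: "\<And>p. p \<in> M \<Longrightarrow> \<exists>q\<in>M. q \<noteq> p \<and> q \<inter> p \<noteq> {}"
  shows "2 * card T \<le> 3 * card M"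
proof -
  define deg where "deg x = card {p\<in>M. x \<in> p}" for x
  have "M \<subseteq> Pow T" using M by auto
  then have finM: "finite M" using T by (simp add: finite_subset)
  \<comment> \<open>At degree 0 there would be no pair to receive the weight of \<open>x\<close>,
    and \<open>1 / real (deg x)\<close> would be 0.\<close>
  have deg1: "deg x \<ge> 1" if "x \<in> T" for x
  proof -
    have "{p\<in>M. x \<in> p} \<noteq> {}" using vertex[OF that] by auto
    then show ?thesis using finM by (simp add: deg_def Suc_le_eq card_gt_0_iff)
  qed
  have pair: "(\<Sum>x\<in>p. 1 / real (deg x)) \<le> 3 / 2" if p: "p \<in> M" for p
  proof -
    obtain q z where q: "q \<in> M" "q \<noteq> p" "z \<in> q" "z \<in> p" using edge[OF p] by auto
    obtain w where w: "p = {z, w}" "z \<noteq> w"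
      using M[OF p] q(4) unfolding card_2_iff by auto
    have "card {p, q} \<le> deg z"
      unfolding deg_def using finM p q by (intro card_mono) auto
    then have "2 \<le> deg z" using q(2) by simp
    then have "1 / real (deg z) \<le> 1 / 2" by (simp add: field_simps)
    moreover have "1 / real (deg w) \<le> 1" using deg1[of w] M[OF p] w by (simp add: field_simps)
    ultimately show ?thesis using w by simp
  qed
  have "real (card T) = (\<Sum>x\<in>T. \<Sum>p | p \<in> M \<and> x \<in> p. 1 / real (deg x))"
  proof -
    have "(\<Sum>p | p \<in> M \<and> x \<in> p. 1 / real (deg x)) = 1" if "x \<in> T" for x
      using deg1[OF that] by (simp add: deg_def[symmetric])
    then have "(\<Sum>x\<in>T. \<Sum>p | p \<in> M \<and> x \<in> p. 1 / real (deg x)) = (\<Sum>x\<in>T. 1)"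
      by (rule sum.cong[OF refl])
    then show ?thesis by simp
  qed
  also have "\<dots> = (\<Sum>p\<in>M. \<Sum>x | x \<in> T \<and> x \<in> p. 1 / real (deg x))"
    using T finM by (rule sum.swap_restrict)
  also have "\<dots> = (\<Sum>p\<in>M. \<Sum>x\<in>p. 1 / real (deg x))"
  proof (intro sum.cong refl)
    show "{x. x \<in> T \<and> x \<in> p} = p" if "p \<in> M" for p using M[OF that] by auto
  qed
  also have "\<dots> \<le> (\<Sum>p\<in>M. 3 / 2)" using pair by (rule sum_mono)
  finally show ?thesis by simp
qed

section \<open>Friends and complete sets\<close>

locale friendship =
  fixes r :: nat and V :: "'a set" and E :: "'a set set"
  assumes r_ge: "r \<ge> 3" and friendship: "friendship_hypergraph r V E"
begin

definition complete_sets :: "'a set set" where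
  "complete_sets = {T. T \<subseteq> V \<and> card T = r + 1 \<and> (\<forall>x\<in>T. T - {x} \<in> E)}"

lemma finite_V: "finite V"
  and edge_subset: "e \<in> E \<Longrightarrow> e \<subseteq> V"
  and card_edge: "e \<in> E \<Longrightarrow> card e = r"
  using friendship by (auto simp: friendship_hypergraph_def uniform_hypergraph_def)

lemma finite_E: "finite E"
  using finite_V edge_subset by (meson Pow_iff finite_Pow_iff finite_subset subsetI)

lemma finite_complete_sets: "finite complete_sets"
  by (rule finite_subset[of _ "Pow V"]) (use finite_V in \<open>auto simp: complete_sets_def\<close>)

lemma complete_setsD:
  assumes "T \<in> complete_sets"
  shows "T \<subseteq> V" "card T = r + 1" "finite T" "\<And>x. x \<in> T \<Longrightarrow> T - {x} \<in> E"
  using assms finite_V finite_subset by (auto simp: complete_sets_def)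

text \<open>An \<open>(r-1)\<close>-subset of an \<open>r\<close>-set arises by deleting a single
  point.\<close>

lemma is_friend_iff:
  assumes A: "A \<subseteq> V" "card A = r"
  shows "is_friend r V E A u \<longleftrightarrow> u \<in> V - A \<and> (\<forall>x\<in>A. insert u (A - {x}) \<in> E)"
proof -
  have fin: "finite A" using A finite_V finite_subset by blast
  have "\<exists>x\<in>A. B = A - {x}" if B: "B \<subseteq> A" "card B = r - 1" for B
  proof -
    have "card (A - B) = 1"
      using B A fin r_ge by (simp add: card_Diff_subset finite_subset)
    then obtain x where "A - B = {x}" by (rule card_1_singletonE)
    then show ?thesis using B by blast
  qed
  moreover have "card (A - {x}) = r - 1" if "x \<in> A" for x
    using that fin A by simp
  ultimately have "(\<forall>B. B \<subseteq> A \<and> card B = r - 1 \<longrightarrow> B \<union> {u} \<in> E) \<longleftrightarrow>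
      (\<forall>x\<in>A. insert u (A - {x}) \<in> E)"
    by (metis Diff_subset Un_insert_right sup_bot.right_neutral)
  then show ?thesis by (auto simp: is_friend_def)
qed

lemma friend_ex:
  assumes "A \<subseteq> V" "card A = r"
  shows "\<exists>u. u \<in> V - A \<and> (\<forall>x\<in>A. insert u (A - {x}) \<in> E)"
proof -
  obtain u where "is_friend r V E A u"
    using friendship assms unfolding friendship_hypergraph_def by blast
  then show ?thesis using is_friend_iff[OF assms] by blast
qed

lemma friend_unique:
  assumes "A \<subseteq> V" "card A = r"
    and "u \<in> V - A" "\<And>x. x \<in> A \<Longrightarrow> insert u (A - {x}) \<in> E"
    and "w \<in> V - A" "\<And>x. x \<in> A \<Longrightarrow> insert w (A - {x}) \<in> E"
  shows "u = w"
proof -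
  have "is_friend r V E A u" "is_friend r V E A w"
    using assms by (auto simp: is_friend_iff)
  then show ?thesis
    using friendship assms(1,2) unfolding friendship_hypergraph_def by blast
qed

text \<open>The complete sets containing \<open>e\<close> are the sets \<open>insert u e\<close>
  with \<open>u\<close> a friend of \<open>e\<close>: deleting \<open>u\<close> leaves
  \<open>e\<close>, and the other deletions are the hyperedges that friendship demands. Existence
  and uniqueness of the friend give the count.\<close>

lemma edge_in_one_complete_set:
  assumes e: "e \<in> E"
  shows "card {T\<in>complete_sets. e \<subseteq> T} = 1"
proof -
  have eV: "e \<subseteq> V" "card e = r" using e edge_subset card_edge by auto
  have fin: "finite e" using eV finite_V finite_subset by blast
  obtain u where u: "u \<in> V - e" "\<And>x. x \<in> e \<Longrightarrow> insert u (e - {x}) \<in> E"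
    using friend_ex[OF eV] by blast
  have "insert u e \<in> complete_sets"
  proof -
    have "insert u e - {x} \<in> E" if "x \<in> insert u e" for x
    proof (cases "x = u")
      case True
      then show ?thesis using u e by simp
    next
      case False
      then have "insert u e - {x} = insert u (e - {x})" by auto
      then show ?thesis using u(2)[of x] that False by auto
    qed
    then show ?thesis using u eV fin by (simp add: complete_sets_def)
  qed
  moreover have "T = insert u e" if T: "T \<in> complete_sets" "e \<subseteq> T" for T
  proof -
    note TD = complete_setsD[OF T(1)]
    have "card (T - e) = 1" using T(2) fin TD eV by (simp add: card_Diff_subset)
    then obtain w where w: "T - e = {w}" by (rule card_1_singletonE)
    have Tw: "T = insert w e" using w T(2) by auto
    have we: "w \<in> V - e" using w TD(1) by auto
    have "insert w (e - {x}) \<in> E" if "x \<in> e" for x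
    proof -
      have "insert w (e - {x}) = T - {x}" using Tw we that by auto
      then show ?thesis using TD(4)[of x] that T(2) by auto
    qed
    then have "w = u" using friend_unique[OF eV] we u by blast
    then show ?thesis using Tw by simp
  qed
  ultimately have "{T\<in>complete_sets. e \<subseteq> T} = {insert u e}" by auto
  then show ?thesis by simp
qed

text \<open>The hyperedges inside \<open>T\<close> are the sets \<open>T - {x}\<close>, and such a
  set contains \<open>S\<close> just when \<open>x\<close> lies outside \<open>S\<close>.\<close>

lemma card_edges_in_complete_set:
  assumes T: "T \<in> complete_sets" and S: "S \<subseteq> T"
  shows "card {e\<in>E. S \<subseteq> e \<and> e \<subseteq> T} = r + 1 - card S"
proof -
  note TD = complete_setsD[OF T]
  have "{e\<in>E. S \<subseteq> e \<and> e \<subseteq> T} = (\<lambda>x. T - {x}) ` (T - S)"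
  proof (intro set_eqI iffI)
    fix e assume e: "e \<in> {e\<in>E. S \<subseteq> e \<and> e \<subseteq> T}"
    then have "card (T - e) = 1"
      using TD card_edge[of e] by (simp add: card_Diff_subset finite_subset[of e T])
    then obtain x where "T - e = {x}" by (rule card_1_singletonE)
    then have "e = T - {x}" "x \<in> T - S" using e by auto
    then show "e \<in> (\<lambda>x. T - {x}) ` (T - S)" by blast
  qed (use S TD(4) in auto)
  moreover have "inj_on (\<lambda>x. T - {x}) (T - S)" by (auto simp: inj_on_def)
  ultimately show ?thesis
    using S TD by (simp add: card_image card_Diff_subset finite_subset)
qed

text \<open>Double counting of the pairs of a hyperedge \<open>e\<close> and a complete set
  \<open>T\<close> with \<open>S\<close> inside \<open>e\<close> and \<open>e\<close> inside
  \<open>T\<close>; each \<open>e\<close> has only one such \<open>T\<close>. It is applied to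
  \<open>(r-1)\<close>-sets, where the factor is 2, and to the empty set, where it relates
  \<open>card E\<close> to the number of complete sets.\<close>

lemma hdegree_complete_sets:
  "hdegree E S = (r + 1 - card S) * card {T\<in>complete_sets. S \<subseteq> T}"
proof -
  define K where "K = {T\<in>complete_sets. S \<subseteq> T}"
  define D where "D = {e\<in>E. S \<subseteq> e}"
  have fin: "finite K" "finite D" by (simp_all add: K_def D_def finite_complete_sets finite_E)
  have "(\<Sum>T\<in>K. \<Sum>e | e \<in> D \<and> e \<subseteq> T. 1) = (\<Sum>e\<in>D. \<Sum>T | T \<in> K \<and> e \<subseteq> T. 1::nat)"
    using fin by (rule sum.swap_restrict)
  moreover have "card {e. e \<in> D \<and> e \<subseteq> T} = r + 1 - card S" if "T \<in> K" for T
    using card_edges_in_complete_set[of T S] that by (simp add: K_def D_def conj_assoc)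
  moreover have "card {T. T \<in> K \<and> e \<subseteq> T} = 1" if "e \<in> D" for e
  proof -
    have "{T. T \<in> K \<and> e \<subseteq> T} = {T\<in>complete_sets. e \<subseteq> T}"
      using that by (auto simp: K_def D_def)
    then show ?thesis using edge_in_one_complete_set[of e] that by (simp add: D_def)
  qed
  ultimately have "card K * (r + 1 - card S) = card D" by simp
  then show ?thesis by (simp add: hdegree_def K_def D_def mult.commute)
qed

section \<open>Hyperedges near a complete set\<close>

lemma card_missing_pairs:
  assumes T: "T \<in> complete_sets" and v: "v \<in> V - T"
  shows "2 * (r + 1) \<le> 3 * card {p. p \<subseteq> T \<and> card p = 2 \<and> insert v (T - p) \<notin> E}"
proof -
  define M where "M = {p. p \<subseteq> T \<and> card p = 2 \<and> insert v (T - p) \<notin> E}"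
  note TD = complete_setsD[OF T]
  have vertex: "\<exists>p\<in>M. x \<in> p" if x: "x \<in> T" for x
  proof (rule ccontr)
    assume no: "\<not> (\<exists>p\<in>M. x \<in> p)"
    have "insert v (T - {x} - {y}) \<in> E" if "y \<in> T - {x}" for y
    proof -
      have "card {x, y} = 2" "{x, y} \<subseteq> T" using that x by auto
      then have "insert v (T - {x, y}) \<in> E" using no by (auto simp: M_def)
      then show ?thesis by (simp add: Diff_insert2[symmetric] insert_commute)
    qed
    moreover have "insert x (T - {x} - {y}) \<in> E" if "y \<in> T - {x}" for y
    proof -
      have "insert x (T - {x} - {y}) = T - {y}" using that x by auto
      then show ?thesis using TD(4) that by simp
    qed
    moreover have "T - {x} \<subseteq> V" "card (T - {x}) = r" using TD x by auto
    ultimately have "v = x" using friend_unique[of "T - {x}" v x] v x TD(1) by blast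
    then show False using v x by blast
  qed
  have edge: "\<exists>q\<in>M. q \<noteq> p \<and> q \<inter> p \<noteq> {}" if p: "p \<in> M" for p
  proof (rule ccontr)
    assume no: "\<not> (\<exists>q\<in>M. q \<noteq> p \<and> q \<inter> p \<noteq> {})"
    define A where "A = insert v (T - p)"
    have pT: "p \<subseteq> T" "card p = 2" using p by (auto simp: M_def)
    have A: "A \<subseteq> V" "card A = r"
      using v TD pT r_ge by (auto simp: A_def card_Diff_subset finite_subset)
    \<comment> \<open>The ends of \<open>p\<close> are ordered here so that the claim serves both of
      them. Replacing \<open>v\<close> by \<open>x\<close> gives \<open>T - {y}\<close>. For any
      other \<open>z\<close>, the pair \<open>{y, z}\<close> meets \<open>p\<close> in
      \<open>y\<close>, so by isolation of \<open>p\<close> it is not in \<open>M\<close>.\<close>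
    have friend: "insert x (A - {z}) \<in> E" if xy: "p = {x, y}" "x \<noteq> y" and z: "z \<in> A" for x y z
    proof (cases "z = v")
      case True
      then have "insert x (A - {z}) = T - {y}" using xy v pT by (auto simp: A_def)
      then show ?thesis using TD(4) xy pT by simp
    next
      case False
      then have z': "z \<in> T" "z \<noteq> x" "z \<noteq> y" using z xy by (auto simp: A_def)
      then have "{y, z} \<noteq> p" "{y, z} \<inter> p \<noteq> {}" "card {y, z} = 2" "{y, z} \<subseteq> T"
        using xy pT by auto
      then have "insert v (T - {y, z}) \<in> E" using no by (auto simp: M_def)
      moreover have "insert x (A - {z}) = insert v (T - {y, z})"
        using xy pT z' False by (auto simp: A_def)
      ultimately show ?thesis by simp
    qed
    obtain x y where xy: "p = {x, y}" "x \<noteq> y" using pT(2) unfolding card_2_iff by auto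
    have yx: "p = {y, x}" using xy by auto
    have "x \<in> V - A" "y \<in> V - A" using xy pT TD(1) v by (auto simp: A_def)
    then have "x = y"
      using friend_unique[OF A] friend[OF xy] friend[OF yx xy(2)[symmetric]] by blast
    then show False using xy by blast
  qed
  have "2 * card T \<le> 3 * card M"
    using TD(3) _ vertex edge by (rule card_pairs_no_isolated) (auto simp: M_def)
  then show ?thesis using TD(2) by (simp add: M_def)
qed

text \<open>For each of the \<open>n - r - 1\<close> vertices outside \<open>T\<close>, where
  \<open>n = card V\<close>, at least \<open>2 * (r + 1) / 3\<close> of the
  \<open>r * (r + 1) / 2\<close> pairs are missing. This leaves at most
  \<open>(r + 1) * (3 * r - 4) / 6\<close>, and the floor is justified because the count is an
  integer.\<close>

lemma card_edges_near_complete_set: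
  assumes T: "T \<in> complete_sets"
  shows "real (card {e\<in>E. card (e \<inter> T) = r - 1}) \<le>
    of_int \<lfloor>(real r + 1) * (3 * real r - 4) / 6\<rfloor> * (real (card V) - real r - 1)"
proof -
  define f where "f = \<lfloor>(real r + 1) * (3 * real r - 4) / 6\<rfloor>"
  define P where "P v = {p. p \<subseteq> T \<and> card p = 2 \<and> insert v (T - p) \<in> E}" for v
  note TD = complete_setsD[OF T]
  have finP: "finite (P v)" for v
    by (rule finite_subset[of _ "Pow T"]) (use TD in \<open>auto simp: P_def\<close>)
  have cardP: "real (card (P v)) \<le> of_int f" if v: "v \<in> V - T" for v
  proof -
    define M where "M = {p. p \<subseteq> T \<and> card p = 2 \<and> insert v (T - p) \<notin> E}"
    have "finite M" by (rule finite_subset[of _ "Pow T"]) (use TD in \<open>auto simp: M_def\<close>)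
    moreover have "P v \<inter> M = {}" "P v \<union> M = {p. p \<subseteq> T \<and> card p = 2}"
      by (auto simp: P_def M_def)
    ultimately have "card (P v) + card M = (r + 1) choose 2"
      using n_subsets[OF TD(3), of 2] card_Un_disjoint[of "P v" M] finP TD(2) by simp
    then have "2 * (card (P v) + card M) = (r + 1) * r" by (simp add: choose_two)
    then have "2 * (real (card (P v)) + real (card M)) = (real r + 1) * real r"
      by (metis of_nat_1 of_nat_add of_nat_mult of_nat_numeral)
    moreover have "real (2 * (r + 1)) \<le> real (3 * card M)"
      unfolding of_nat_le_iff M_def by (rule card_missing_pairs[OF T v])
    ultimately have "real (card (P v)) \<le> (real r + 1) * (3 * real r - 4) / 6"
      by (simp add: algebra_simps)
    then have "int (card (P v)) \<le> f" unfolding f_def by (simp add: le_floor_iff)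
    then show ?thesis by linarith
  qed
  \<comment> \<open>Such an \<open>e\<close> has one vertex \<open>v\<close> outside
    \<open>T\<close> and omits a pair \<open>T - e\<close> of \<open>T\<close>; these two data
    determine it.\<close>
  have "{e\<in>E. card (e \<inter> T) = r - 1} \<subseteq> (\<lambda>(v, p). insert v (T - p)) ` Sigma (V - T) P"
  proof
    fix e assume e: "e \<in> {e\<in>E. card (e \<inter> T) = r - 1}"
    then have eV: "e \<subseteq> V" "card e = r" "finite e"
      using edge_subset card_edge finite_V finite_subset by blast+
    have "card (e - T) = card e - card (e \<inter> T)"
      by (rule card_Diff_subset_Int) (use eV in simp)
    also have "\<dots> = 1" using e eV r_ge by simp
    finally obtain v where v: "e - T = {v}" by (rule card_1_singletonE)
    have "card (T - e) = card T - card (T \<inter> e)"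
      by (rule card_Diff_subset_Int) (use eV in simp)
    then have "card (T - e) = 2" using e TD r_ge by (simp add: Int_commute)
    moreover have "e = insert v (T - (T - e))" using v by auto
    ultimately have "T - e \<in> P v" using e by (simp add: P_def)
    moreover have "v \<in> V - T" using v eV by auto
    ultimately show "e \<in> (\<lambda>(v, p). insert v (T - p)) ` Sigma (V - T) P"
      using \<open>e = insert v (T - (T - e))\<close> by (intro image_eqI[of _ _ "(v, T - e)"]) auto
  qed
  moreover have fin: "finite (Sigma (V - T) P)" using finite_V finP by blast
  ultimately have "card {e\<in>E. card (e \<inter> T) = r - 1} \<le> card (Sigma (V - T) P)"
    by (rule surj_card_le[rotated])
  also have "\<dots> = (\<Sum>v\<in>V - T. card (P v))" using finite_V finP by simp
  finally have "real (card {e\<in>E. card (e \<inter> T) = r - 1}) \<le> (\<Sum>v\<in>V - T. real (card (P v)))"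
    by (metis of_nat_le_iff of_nat_sum)
  also have "\<dots> \<le> (\<Sum>v\<in>V - T. of_int f)" using cardP by (rule sum_mono)
  also have "\<dots> = of_int f * (real (card V) - real r - 1)"
  proof -
    have "card T \<le> card V" using TD finite_V card_mono by blast
    then show ?thesis using TD by (simp add: card_Diff_subset of_nat_diff mult.commute)
  qed
  finally show ?thesis by (simp add: f_def)
qed

text \<open>A hyperedge containing \<open>S\<close> has just one further vertex, so it meets
  \<open>T\<close> exactly in \<open>S\<close> or lies inside \<open>T\<close>. The 2 counts the
  latter kind, one for each vertex of \<open>T - S\<close>.\<close>

lemma card_edges_meeting_in:
  assumes T: "T \<in> complete_sets" and S: "S \<subseteq> T" "card S = r - 1"
  shows "real (card {e\<in>E. e \<inter> T = S}) = real (hdegree E S) - 2"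
proof -
  have "{e\<in>E. S \<subseteq> e} = {e\<in>E. e \<inter> T = S} \<union> {e\<in>E. S \<subseteq> e \<and> e \<subseteq> T}"
  proof -
    have "e \<subseteq> T" if e: "e \<in> E" "S \<subseteq> e" "e \<inter> T \<noteq> S" for e
    proof -
      have fin: "finite e" using e edge_subset finite_V finite_subset by blast
      have "S \<subset> e \<inter> T" using e S by auto
      then have "card S < card (e \<inter> T)" using fin by (intro psubset_card_mono) auto
      then have "card e \<le> card (e \<inter> T)" using S card_edge[OF e(1)] r_ge by simp
      then have "e \<inter> T = e" using fin by (intro card_seteq) auto
      then show ?thesis by auto
    qed
    then show ?thesis using S by auto
  qed
  moreover have "{e\<in>E. e \<inter> T = S} \<inter> {e\<in>E. S \<subseteq> e \<and> e \<subseteq> T} = {}"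
    using S card_edge r_ge by (auto simp: Int_absorb2)
  ultimately have "hdegree E S = card {e\<in>E. e \<inter> T = S} + card {e\<in>E. S \<subseteq> e \<and> e \<subseteq> T}"
    using finite_E by (simp add: hdegree_def card_Un_disjoint)
  then show ?thesis using card_edges_in_complete_set[OF T S(1)] S r_ge by simp
qed

section \<open>Degree sums over the \<open>(r-1)\<close>-sets\<close>

abbreviation "small_sets \<equiv> {S. S \<subseteq> V \<and> card S = r - 1}"

lemma finite_small_sets: "finite small_sets"
  using finite_V by simp

lemma sum_hdegree: "(\<Sum>S\<in>small_sets. hdegree E S) = r * card E"
proof -
  have "(\<Sum>S\<in>small_sets. \<Sum>e | e \<in> E \<and> S \<subseteq> e. 1) =
      (\<Sum>e\<in>E. \<Sum>S | S \<in> small_sets \<and> S \<subseteq> e. 1::nat)"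
    using finite_small_sets finite_E by (rule sum.swap_restrict)
  moreover have "card {S. S \<in> small_sets \<and> S \<subseteq> e} = r" if e: "e \<in> E" for e
  proof -
    have "{S. S \<in> small_sets \<and> S \<subseteq> e} = {S. S \<subseteq> e \<and> card S = r - 1}"
      using edge_subset[OF e] by auto
    moreover have "finite e" using edge_subset[OF e] finite_V finite_subset by blast
    moreover have "r choose (r - 1) = r" using r_ge binomial_symmetric[of 1 r] by simp
    ultimately show ?thesis using n_subsets[of e "r - 1"] card_edge[OF e] by simp
  qed
  ultimately show ?thesis by (simp add: hdegree_def)
qed

text \<open>Sorting the hyperedges near \<open>T\<close> by their trace \<open>S\<close> on
  \<open>T\<close> gives \<open>hdegree E S - 2\<close> for each \<open>S\<close>. After exchanging
  the sums, each \<open>S\<close> is counted once for every complete set above it, that is,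
  \<open>hdegree E S / 2\<close> times.\<close>

lemma sum_hdegree_edges_near:
  "(\<Sum>T\<in>complete_sets. real (card {e\<in>E. card (e \<inter> T) = r - 1})) =
   (\<Sum>S\<in>small_sets. real (hdegree E S) * (real (hdegree E S) - 2) / 2)"
proof -
  have "(\<Sum>T\<in>complete_sets. real (card {e\<in>E. card (e \<inter> T) = r - 1})) =
      (\<Sum>T\<in>complete_sets. \<Sum>S | S \<in> small_sets \<and> S \<subseteq> T. real (hdegree E S) - 2)"
  proof (rule sum.cong[OF refl])
    fix T assume T: "T \<in> complete_sets"
    note TD = complete_setsD[OF T]
    have "{e\<in>E. card (e \<inter> T) = r - 1} =
        (\<Union>S\<in>{S. S \<in> small_sets \<and> S \<subseteq> T}. {e\<in>E. e \<inter> T = S})"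
      using TD(1) by auto
    moreover have "card (\<Union>S\<in>{S. S \<in> small_sets \<and> S \<subseteq> T}. {e\<in>E. e \<inter> T = S}) =
        (\<Sum>S | S \<in> small_sets \<and> S \<subseteq> T. card {e\<in>E. e \<inter> T = S})"
      using finite_V finite_E by (intro card_UN_disjoint) auto
    ultimately show "real (card {e\<in>E. card (e \<inter> T) = r - 1}) =
        (\<Sum>S | S \<in> small_sets \<and> S \<subseteq> T. real (hdegree E S) - 2)"
      using card_edges_meeting_in[OF T] by simp
  qed
  also have "\<dots> = (\<Sum>S\<in>small_sets. \<Sum>T | T \<in> complete_sets \<and> S \<subseteq> T. real (hdegree E S) - 2)"
    using finite_complete_sets finite_small_sets by (rule sum.swap_restrict)
  also have "\<dots> = (\<Sum>S\<in>small_sets. real (hdegree E S) * (real (hdegree E S) - 2) / 2)"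
  proof (rule sum.cong[OF refl])
    fix S assume "S \<in> small_sets"
    then have "hdegree E S = 2 * card {T\<in>complete_sets. S \<subseteq> T}"
      using hdegree_complete_sets[of S] r_ge by simp
    then show "(\<Sum>T | T \<in> complete_sets \<and> S \<subseteq> T. real (hdegree E S) - 2) =
        real (hdegree E S) * (real (hdegree E S) - 2) / 2"
      by simp
  qed
  finally show ?thesis .
qed

text \<open>An upper bound on the second moment of the degrees: the estimate for a single
  \<open>T\<close> is summed over all complete sets, and \<open>sum_hdegree\<close> evaluates the
  linear term. The factor \<open>r + 1\<close> turns the number of complete sets into
  \<open>card E\<close>.\<close>

lemma sum_hdegree_squares_le:
  "(real r + 1) * (\<Sum>S\<in>small_sets. (real (hdegree E S))\<^sup>2) \<le>
   real (card E) * (2 * of_int \<lfloor>(real r + 1) * (3 * real r - 4) / 6\<rfloor> * (real (card V) - real r - 1)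
     + 2 * real r * (real r + 1))"
proof -
  define c where
    "c = of_int \<lfloor>(real r + 1) * (3 * real r - 4) / 6\<rfloor> * (real (card V) - real r - 1)"
  define Q where "Q = (\<Sum>S\<in>small_sets. (real (hdegree E S))\<^sup>2)"
  have sum: "(\<Sum>S\<in>small_sets. real (hdegree E S)) = real r * real (card E)"
    using sum_hdegree by (metis of_nat_mult of_nat_sum)
  have "(\<Sum>S\<in>small_sets. real (hdegree E S) * (real (hdegree E S) - 2) / 2) =
      (\<Sum>S\<in>small_sets. (real (hdegree E S))\<^sup>2 / 2 - real (hdegree E S))"
    by (intro sum.cong refl) (simp add: power2_eq_square field_simps)
  also have "\<dots> = Q / 2 - real r * real (card E)"
    unfolding Q_def sum[symmetric] by (simp add: sum_subtractf sum_divide_distrib)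
  finally have "Q / 2 - real r * real (card E) =
      (\<Sum>T\<in>complete_sets. real (card {e\<in>E. card (e \<inter> T) = r - 1}))"
    by (simp only: sum_hdegree_edges_near)
  also have "\<dots> \<le> (\<Sum>T\<in>complete_sets. c)"
    unfolding c_def by (rule sum_mono) (rule card_edges_near_complete_set)
  finally have "Q / 2 - real r * real (card E) \<le> (\<Sum>T\<in>complete_sets. c)" .
  then have "Q \<le> 2 * (real (card complete_sets) * c) + 2 * (real r * real (card E))"
    by simp
  then have "(real r + 1) * Q \<le>
      (real r + 1) * (2 * (real (card complete_sets) * c) + 2 * (real r * real (card E)))"
    by (intro mult_left_mono) auto
  also have "\<dots> = 2 * ((real r + 1) * real (card complete_sets)) * c
      + 2 * (real r * real (card E)) * (real r + 1)"
    by (simp add: algebra_simps)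
  \<comment> \<open>The degree of the empty set is the number of all hyperedges.\<close>
  also have "(real r + 1) * real (card complete_sets) = real (card E)"
    using hdegree_complete_sets[of "{}"] by (simp add: hdegree_def algebra_simps)
  finally show ?thesis by (simp add: Q_def c_def algebra_simps)
qed

end

section \<open>Rewriting the bound\<close>

text \<open>Brings the bound into the shape of the right-hand side of
  \<open>sum_hdegree_squares_le\<close>.\<close>

lemma friendship_bound_eq:
  assumes r: "r \<ge> 1" and n: "n \<ge> r"
  shows "real r ^ 2 * (real r + 1) * friendship_bound r n = real (n choose (r - 1)) *
    (2 * of_int \<lfloor>(real r + 1) * (3 * real r - 4) / 6\<rfloor> * (real n - real r - 1)
     + 2 * real r * (real r + 1))"
proof -
  define f where "f = \<lfloor>(real r + 1) * (3 * real r - 4) / 6\<rfloor>"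
  define g where "g = \<lceil>2 * (real r + 1) / 3\<rceil>"
  \<comment> \<open>The arguments of floor and ceiling add up to the integer
    \<open>(r + 1) choose 2\<close>, hence so do \<open>f\<close> and \<open>g\<close>.\<close>
  have fg: "real_of_int f = real r * (real r + 1) / 2 - of_int g"
  proof -
    define h where "h = (r + 1) choose 2"
    have "2 * h = (r + 1) * r" by (simp add: h_def choose_two)
    then have h: "2 * real h = (real r + 1) * real r"
      by (metis of_nat_1 of_nat_add of_nat_mult of_nat_numeral)
    then have "(real r + 1) * (3 * real r - 4) / 6 = - (2 * (real r + 1) / 3) + of_int (int h)"
      by (simp add: field_simps)
    then have "f = - g + int h"
      unfolding f_def g_def ceiling_def by (metis floor_add_int minus_minus)
    then show ?thesis using h by (simp add: algebra_simps)
  qed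
  have "r * (n choose r) = (n - r + 1) * (n choose (r - 1))"
    using binomial_absorption[of "r - 1" "n"] binomial_absorb_comp[of n "r - 1"] r n
    by (cases r) (auto simp: Suc_diff_Suc)
  then have "real (r * (n choose r)) = real ((n - r + 1) * (n choose (r - 1)))"
    by simp
  then have ch: "real r * real (n choose r) = (real n - real r + 1) * real (n choose (r - 1))"
    using n by (simp add: of_nat_diff distrib_right)
  have "real r ^ 2 * (real r + 1) * friendship_bound r n =
      2 * of_int f * (real r * real (n choose r)) + 4 * of_int g * real (n choose (r - 1))"
  proof -
    define s where "s = real r + 1"
    have "s \<noteq> 0" "real r \<noteq> 0" using r by (auto simp: s_def)
    then show ?thesis
      unfolding friendship_bound_def f_def[symmetric] g_def[symmetric]
      unfolding s_def[symmetric]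
      by (simp add: field_simps power2_eq_square)
  qed
  \<comment> \<open>Splitting \<open>n - r + 1\<close> as \<open>(n - r - 1) + 2\<close> frees a
    term \<open>4 * f\<close>, which joins \<open>4 * g\<close>.\<close>
  also have "\<dots> = real (n choose (r - 1)) *
      (2 * of_int f * (real n - real r - 1) + 4 * (of_int f + of_int g))"
    unfolding ch by (simp add: algebra_simps)
  also have "4 * (real_of_int f + of_int g) = 2 * real r * (real r + 1)"
    using fg by simp
  finally show ?thesis by (simp add: f_def)
qed

text \<open>From \<open>r \<ge> 2\<close> on, \<open>3 * r - 4\<close> under the floor is positive.
  This covers a hypergraph without hyperedges in the final argument.\<close>

lemma friendship_bound_nonneg:
  assumes "r \<ge> 2"
  shows "friendship_bound r n \<ge> 0"
  using assms unfolding friendship_bound_def by (intro add_nonneg_nonneg mult_nonneg_nonneg) auto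

section \<open>Variance of the degrees and the equality case\<close>

theorem theorem2:
  fixes r n :: nat and V :: "'a set" and E :: "'a set set"
  assumes "r \<ge> 3"
    and "friendship_hypergraph r V E"
    and "card V = n"
    and "n \<ge> r + 1"
  shows "real (card E) \<le> friendship_bound r n
    \<and> (real (card E) = friendship_bound r n \<longrightarrow>
        (\<exists>d. \<forall>S. S \<subseteq> V \<and> card S = r - 1 \<longrightarrow> hdegree E S = d))"
proof -
  interpret friendship r V E using assms by unfold_locales
  define N where "N = real (n choose (r - 1))"
  define m where "m = real (card E)"
  \<comment> \<open>The mean degree of an \<open>(r-1)\<close>-set, since the degrees sum to
    \<open>r * m\<close>.\<close>
  define \<mu> where "\<mu> = real r * m / N"
  define b where "b = friendship_bound r n"
  define Q where "Q = (\<Sum>S\<in>small_sets. (real (hdegree E S))\<^sup>2)"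
  have N: "N > 0" using assms(4) by (simp add: N_def)
  have cardN: "real (card small_sets) = N"
    using n_subsets[OF finite_V, of "r - 1"] assms(3) by (simp add: N_def)
  have sum: "(\<Sum>S\<in>small_sets. real (hdegree E S)) = real r * m"
    using sum_hdegree unfolding m_def by (metis of_nat_mult of_nat_sum)
  have "(real r + 1) * (N * Q) = N * ((real r + 1) * Q)" by simp
  also have "\<dots> \<le> N * (m * (2 * of_int \<lfloor>(real r + 1) * (3 * real r - 4) / 6\<rfloor> *
      (real n - real r - 1) + 2 * real r * (real r + 1)))"
    using sum_hdegree_squares_le N unfolding Q_def m_def assms(3) by (intro mult_left_mono) auto
  also have "\<dots> = m * (real r ^ 2 * (real r + 1) * b)"
    using friendship_bound_eq[of r n] assms unfolding b_def N_def by (simp only: mult.left_commute)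
  finally have "(real r + 1) * (N * Q) \<le> (real r + 1) * (real r ^ 2 * m * b)"
    by (simp add: algebra_simps)
  then have NQ: "N * Q \<le> real r ^ 2 * m * b"
    by (rule mult_left_le_imp_le) simp
  \<comment> \<open>Cauchy-Schwarz in variance form: the deviations from the mean measure the gap
    between \<open>N * Q\<close> and the squared degree sum. Keeping this gap yields the bound and
    the equality case from one inequality.\<close>
  have "(\<Sum>S\<in>small_sets. (real (hdegree E S) - \<mu>)\<^sup>2) =
      (\<Sum>S\<in>small_sets. (real (hdegree E S))\<^sup>2 - 2 * \<mu> * real (hdegree E S) + \<mu>\<^sup>2)"
    by (intro sum.cong refl) (simp add: power2_eq_square algebra_simps)
  also have "\<dots> = Q - 2 * \<mu> * (real r * m) + N * \<mu>\<^sup>2"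
    unfolding Q_def sum[symmetric] cardN[symmetric]
    by (simp add: sum.distrib sum_subtractf sum_distrib_left)
  finally have "N * (\<Sum>S\<in>small_sets. (real (hdegree E S) - \<mu>)\<^sup>2) = N * Q - (real r * m)\<^sup>2"
    using N by (simp add: \<mu>_def field_simps power2_eq_square)
  also have "\<dots> \<le> real r ^ 2 * m * (b - m)"
    using NQ by (simp add: power2_eq_square algebra_simps)
  finally have variance:
    "N * (\<Sum>S\<in>small_sets. (real (hdegree E S) - \<mu>)\<^sup>2) \<le> real r ^ 2 * m * (b - m)" .
  have var_nonneg: "(\<Sum>S\<in>small_sets. (real (hdegree E S) - \<mu>)\<^sup>2) \<ge> 0"
    by (intro sum_nonneg) auto
  \<comment> \<open>The factor \<open>m\<close> in \<open>variance\<close> can be cancelled only if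
    it is nonzero.\<close>
  have "m \<le> b"
  proof (cases "m = 0")
    case True
    then show ?thesis using friendship_bound_nonneg[of r n] assms(1) by (simp add: b_def)
  next
    case False
    then have "real r ^ 2 * m > 0" using assms(1) by (simp add: m_def)
    moreover have "0 \<le> real r ^ 2 * m * (b - m)"
      using variance var_nonneg N by (meson mult_nonneg_nonneg order.strict_implies_order order.trans)
    ultimately show ?thesis by (simp add: zero_le_mult_iff)
  qed
  \<comment> \<open>Equality makes the right side of \<open>variance\<close> zero, so no degree
    deviates from the mean.\<close>
  moreover have "\<exists>d. \<forall>S. S \<subseteq> V \<and> card S = r - 1 \<longrightarrow> hdegree E S = d" if "m = b"
  proof -
    have "(\<Sum>S\<in>small_sets. (real (hdegree E S) - \<mu>)\<^sup>2) = 0"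
      using variance var_nonneg N that by (simp add: mult_le_0_iff)
    then have "\<forall>S\<in>small_sets. real (hdegree E S) = \<mu>"
      using finite_small_sets by (subst (asm) sum_nonneg_eq_0_iff) auto
    \<comment> \<open>The common degree must be a natural number, whereas \<open>\<mu>\<close> is
      real.\<close>
    then have "\<forall>S\<in>small_sets. hdegree E S = nat \<lfloor>\<mu>\<rfloor>" by force
    then show ?thesis by blast
  qed
  ultimately show ?thesis by (simp add: m_def b_def)
qed

end
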